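(* Let $G$ be an elementary abelian $2$-group of (finite) order different from $4$, $8$ and $16$. Then there is a permutation representation $D\colon G\to\mathrm{GL}(d,\mathbb{R})$ (for some $d$; that is, every $D(g)$ is a permutation matrix) such that the corresponding representation polytope $P(D)$ has affine symmetry group $D(G)$; that is, the affine symmetries of $P(D)$ are exactly the maps induced by left multiplication with the elements of $D(G)$.
   Context: The representation polytope of $D\colon G\to\mathrm{GL}(d,\mathbb{R})$ is $P(D)=\operatorname{conv}\{D(g)\mid g\in G\}$, a polytope in the space of real $d\times d$-matrices. The group $D(G)$ acts on $P(D)$ by left multiplication, and is thereby regarded as a group of affine symmetries of $P(D)$. An affine symmetry of a polytope $P$ is a bijection of $P$ that is the restriction of an affine map of the ambient space. *)

theory Defs
  imports
    "HOL-Algebra.Coset"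
    "HOL-Combinatorics.Permutations"
    "HOL-Library.FuncSet"
    "Jordan_Normal_Form.Matrix"
begin

definition elementary_abelian_2_group :: "('a, 'b) monoid_scheme \<Rightarrow> bool" where
  "elementary_abelian_2_group G \<longleftrightarrow>
     comm_group G \<and> (\<forall>x\<in>carrier G. x \<otimes>\<^bsub>G\<^esub> x = \<one>\<^bsub>G\<^esub>)"

definition GL :: "nat \<Rightarrow> real mat monoid" where
  "GL d = units_of (ring_mat TYPE(real) d ())"

definition permutation_matrix :: "nat \<Rightarrow> real mat \<Rightarrow> bool" where
  "permutation_matrix d A \<longleftrightarrow>
     (\<exists>p. p permutes {..<d} \<and> A = mat d d (\<lambda>(i, j). if i = p j then 1 else 0))"

definition permutation_representation ::
  "('a, 'b) monoid_scheme \<Rightarrow> nat \<Rightarrow> ('a \<Rightarrow> real mat) \<Rightarrow> bool" where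
  "permutation_representation G d D \<longleftrightarrow>
     D \<in> hom G (GL d) \<and> (\<forall>g\<in>carrier G. permutation_matrix d (D g))"

(* The type of matrices of all dimensions is not a real vector space, so convexity and
   affine maps are relativised to the space of d x d matrices, the dimension d being a term.
   The formula for convexity is the one of the library constant convex, so that
   "mat_convex d hull X" is the convex hull of X in this space. *)
definition mat_convex :: "nat \<Rightarrow> real mat set \<Rightarrow> bool" where
  "mat_convex d S \<longleftrightarrow> S \<subseteq> carrier_mat d d \<and>
     (\<forall>A\<in>S. \<forall>B\<in>S. \<forall>u\<ge>0. \<forall>v\<ge>0. u + v = 1 \<longrightarrow> u \<cdot>\<^sub>m A + v \<cdot>\<^sub>m B \<in> S)"

definition representation_polytope ::
  "('a, 'b) monoid_scheme \<Rightarrow> nat \<Rightarrow> ('a \<Rightarrow> real mat) \<Rightarrow> real mat set" where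
  "representation_polytope G d D = mat_convex d hull (D ` carrier G)"

definition mat_linear_map :: "nat \<Rightarrow> (real mat \<Rightarrow> real mat) \<Rightarrow> bool" where
  "mat_linear_map d L \<longleftrightarrow> L \<in> carrier_mat d d \<rightarrow> carrier_mat d d \<and>
     (\<forall>A\<in>carrier_mat d d. \<forall>B\<in>carrier_mat d d. L (A + B) = L A + L B) \<and>
     (\<forall>c. \<forall>A\<in>carrier_mat d d. L (c \<cdot>\<^sub>m A) = c \<cdot>\<^sub>m L A)"

definition mat_affine_map :: "nat \<Rightarrow> (real mat \<Rightarrow> real mat) \<Rightarrow> bool" where
  "mat_affine_map d f \<longleftrightarrow>
     (\<exists>L. \<exists>T\<in>carrier_mat d d. mat_linear_map d L \<and> (\<forall>A\<in>carrier_mat d d. f A = L A + T))"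

(* Symmetries are maps on P alone: two affine maps agreeing on P induce the same symmetry.
   Restriction makes them extensional functions, so they can be compared with equality. *)
definition affine_symmetries :: "nat \<Rightarrow> real mat set \<Rightarrow> (real mat \<Rightarrow> real mat) set" where
  "affine_symmetries d P = {restrict f P | f. mat_affine_map d f \<and> bij_betw f P P}"

end

theory Submission
  imports Defs
begin

text \<open>Identify \<open>G\<close> with the numbers below \<open>2 ^ n\<close> under exclusive or; a set \<open>S\<close> of characters
  containing the trivial one gives a permutation representation whose matrix entries span, as functions
  on \<open>G\<close>, the same space as \<open>S\<close>.  An affine symmetry of the polytope permutes the vertices and
  preserves this space, hence commutes with the orthogonal projection onto it, whose kernel is
  \<open>(g, h) \<mapsto> (\<Sum>c\<in>S. c (g + h)) / 2 ^ n\<close>.  So it suffices to find \<open>S\<close> such that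
  only the translations preserve this kernel.  Up to a constant and a multiple of the identity, replacing
  \<open>S\<close> by its complement negates the kernel.  Passing to one more dimension by adding a
  single independent character (a prism over the polytope) keeps the symmetries trivial if every nonzero
  element is negated by at least two characters in \<open>S\<close>; the complement restores this property, so
  that one explicit set for \<open>n = 5\<close> yields all larger \<open>n\<close> by induction.  For
  \<open>n \<le> 1\<close> a permutation fixing the identity is already trivial.\<close>

section \<open>Characters and rigid sets\<close>

text \<open>Elements of \<open>\<int>\<^sub>2\<^sup>n\<close> and its characters are both encoded as natural numbers
  below \<open>2 ^ n\<close>: \<open>chi a b\<close> is \<open>- 1\<close> to the number of common binary digits of
  \<open>a\<close> and \<open>b\<close>.\<close>

fun chi :: "nat \<Rightarrow> nat \<Rightarrow> real" where
  "chi a b = (if a = 0 then 1 else (if odd a \<and> odd b then - 1 else 1) * chi (a div 2) (b div 2))"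

declare chi.simps [simp del]

text \<open>The case distinction in \<open>chi\<close> serves termination; at \<open>0\<close> the
  recursion holds as well.\<close>

lemma chi_rec: "chi a b = (if odd a \<and> odd b then - 1 else 1) * chi (a div 2) (b div 2)"
  by (cases "a = 0") (simp_all add: chi.simps)

lemma chi_0_left [simp]: "chi 0 b = 1"
  by (simp add: chi.simps)

lemma chi_0_right [simp]: "chi a 0 = 1"
  by (induction a "0::nat" rule: chi.induct) (subst chi.simps, simp)

lemma xor_nat_div_2: "(xor a b :: nat) div 2 = xor (a div 2) (b div 2)"
  by (metis drop_bit_xor drop_bit_Suc drop_bit_0 One_nat_def id_apply)

lemma chi_commute: "chi a b = chi b a"
proof (induction a b rule: chi.induct)
  case (1 a b)
  then show ?case
    by (cases "a = 0") (auto simp: chi_rec [of a b] chi_rec [of b a])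
qed

lemma chi_xor_right: "chi a (xor b c) = chi a b * chi a c"
proof (induction a arbitrary: b c rule: less_induct)
  case (less a)
  show ?case
  proof (cases "a = 0")
    case False
    then have "chi (a div 2) (xor (b div 2) (c div 2)) = chi (a div 2) (b div 2) * chi (a div 2) (c div 2)"
      by (intro less) simp
    then show ?thesis
      by (simp add: chi_rec [of a] xor_nat_div_2 even_xor_iff)
  qed simp
qed

lemma chi_cases: "chi a b = 1 \<or> chi a b = - 1"
proof (induction a b rule: chi.induct)
  case (1 a b)
  then show ?case
    by (cases "a = 0") (auto simp: chi_rec [of a b])
qed

lemma chi_square [simp]: "chi a b * chi a b = 1"
  using chi_cases [of a b] by auto

lemma chi_Suc_0: "chi (Suc 0) g = (if odd g then - 1 else 1)"
  by (simp add: chi.simps)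

lemma chi_double: "chi (2 * c) g = chi c (g div 2)"
  by (subst chi_rec) simp

lemma xor_less_power_2:
  assumes "a < 2 ^ n" "b < 2 ^ n"
  shows "xor a b < (2::nat) ^ n"
  using assms by (metis take_bit_nat_eq_self_iff take_bit_xor)

lemma xor_eq_0_iff: "xor a b = 0 \<longleftrightarrow> a = (b::nat)"
  by (metis xor.assoc xor_self_eq xor.left_neutral xor.right_neutral)

lemma xor_cancel: "xor a (xor a b) = (b::nat)"
  by (simp flip: xor.assoc)

lemma bij_betw_xor:
  assumes "a < 2 ^ n"
  shows "bij_betw (xor a) {..<2 ^ n} {..<(2::nat) ^ n}"
  by (rule bij_betw_byWitness [where f' = "xor a"]) (auto simp: xor_cancel xor_less_power_2 assms)

lemma sum_lessThan_double: "(\<Sum>x<2 * m. f x) = (\<Sum>a<m. f (2 * a) + f (2 * a + 1 :: nat))"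
  for f :: "nat \<Rightarrow> real"
  by (induction m) (simp_all add: algebra_simps)

text \<open>Orthogonality of characters. Pairing \<open>2 * a\<close> with \<open>2 * a + 1\<close>
  splits off the lowest bit of \<open>g\<close>: the two terms cancel if \<open>g\<close> is odd and
  agree otherwise.\<close>

lemma sum_chi:
  assumes "g < 2 ^ n"
  shows "(\<Sum>a<2 ^ n. chi a g) = (if g = 0 then 2 ^ n else 0)"
  using assms
proof (induction n arbitrary: g)
  case (Suc n)
  have "chi (2 * a) g + chi (2 * a + 1) g = (if odd g then 0 else 2 * chi a (g div 2))" for a
    by (subst (1 2) chi_rec) simp
  then have *: "(\<Sum>a<2 ^ Suc n. chi a g) = (\<Sum>a<2 ^ n. if odd g then 0 else 2 * chi a (g div 2))"
    by (simp only: power_Suc sum_lessThan_double)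
  show ?case
  proof (cases "odd g")
    case False
    with Suc.prems have "g div 2 < 2 ^ n" "g div 2 = 0 \<longleftrightarrow> g = 0"
      by auto
    with False Suc.IH [of "g div 2"] show ?thesis
      unfolding * by (simp flip: sum_distrib_left)
  next
    case True
    then have "g \<noteq> 0" by (auto elim: oddE)
    with True show ?thesis unfolding * by simp
  qed
qed auto

section \<open>Character sums and rigidity\<close>

definition char_sum :: "nat set \<Rightarrow> nat \<Rightarrow> real" where
  "char_sum S g = (\<Sum>c\<in>S. chi c g)"

lemma char_sum_0 [simp]: "char_sum S 0 = real (card S)"
  by (simp add: char_sum_def)

lemma char_sum_ge: "- real (card S) \<le> char_sum S g"
proof -
  have "(\<Sum>c\<in>S. - 1) \<le> char_sum S g"
    unfolding char_sum_def using chi_cases by (intro sum_mono) (metis le_minus_one_simps(2) order_refl)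
  then show ?thesis by simp
qed

text \<open>The kernel depends only on \<open>xor g h\<close>, so translations preserve it. The
  normalisation \<open>\<pi> 0 = 0\<close> divides them out: rigidity says that only translations
  preserve the kernel.\<close>

definition rigid :: "nat \<Rightarrow> nat set \<Rightarrow> bool" where
  "rigid n S \<longleftrightarrow>
     (\<forall>\<pi>. bij_betw \<pi> {..<2 ^ n} {..<2 ^ n} \<longrightarrow> \<pi> 0 = 0 \<longrightarrow>
        (\<forall>g<2 ^ n. \<forall>h<2 ^ n. char_sum S (xor (\<pi> g) (\<pi> h)) = char_sum S (xor g h)) \<longrightarrow>
        (\<forall>g<2 ^ n. \<pi> g = g))"

lemma rigidI:
  assumes "\<And>\<pi> g. bij_betw \<pi> {..<2 ^ n} {..<2 ^ n} \<Longrightarrow> \<pi> 0 = 0 \<Longrightarrow>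
    (\<And>g h. g < 2 ^ n \<Longrightarrow> h < 2 ^ n \<Longrightarrow> char_sum S (xor (\<pi> g) (\<pi> h)) = char_sum S (xor g h)) \<Longrightarrow>
    g < 2 ^ n \<Longrightarrow> \<pi> g = g"
  shows "rigid n S"
  unfolding rigid_def using assms by blast

lemma rigidD:
  assumes "rigid n S" "bij_betw \<pi> {..<2 ^ n} {..<2 ^ n}" "\<pi> 0 = 0"
    "\<And>g h. g < 2 ^ n \<Longrightarrow> h < 2 ^ n \<Longrightarrow> char_sum S (xor (\<pi> g) (\<pi> h)) = char_sum S (xor g h)"
    "g < 2 ^ n"
  shows "\<pi> g = g"
  using assms unfolding rigid_def by blast

section \<open>An explicit rigid set in dimension five\<close>

text \<open>This set was found by a computer search.  Its character sum takes its values at \<open>2\<close> and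
  \<open>12\<close> nowhere else; the differences to \<open>0\<close>, \<open>2\<close> and \<open>12\<close> determine
  \<open>1\<close>, and those to \<open>0\<close>, \<open>1\<close>, \<open>2\<close> and \<open>12\<close> determine
  every element.\<close>

definition base_set :: "nat set" where
  "base_set = {1, 2, 4, 5, 8, 9, 16, 21, 23, 24, 25, 27}"

text \<open>The character sums of \<open>base_set\<close>, tabulated as integers so that the finite
  checks can be evaluated.\<close>

definition base_values :: "int list" where
  "base_values =
    [12, -2, 6, 0, 4, 2, 2, 0, 2, 0, 0, -2, -6, 4, -4, -2,
     0, 2, 2, -4, 0, -2, -2, -4, 2, 0, 0, -2, 2, -4, -4, -2]"

lemma char_sum_base_set:
  assumes "g < 32"
  shows "char_sum base_set g = of_int (base_values ! g)"
proof -
  have "map (char_sum base_set) [0..<32] = map of_int base_values"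
    by (simp add: char_sum_def base_set_def base_values_def chi.simps upt_rec)
  then have "map (char_sum base_set) [0..<32] ! g = map of_int base_values ! g"
    by simp
  moreover have "length base_values = 32"
    by (simp add: base_values_def)
  ultimately show ?thesis
    using assms by simp
qed

text \<open>The first three claims recognise successive fixed points of a symmetry. The last one is
  the gap \<open>card base_set - 4\<close> that \<open>extensible\<close> asks for.\<close>

lemma base_values_unique:
  assumes "x < 32"
  shows "base_values ! x = base_values ! 2 \<Longrightarrow> x = 2"
    and "base_values ! x = base_values ! 12 \<Longrightarrow> x = 12"
    and "base_values ! x = base_values ! 1 \<Longrightarrow> base_values ! (xor x 2) = base_values ! xor 1 2 \<Longrightarrow>
      base_values ! xor x 12 = base_values ! xor 1 12 \<Longrightarrow> x = 1"
    and "x \<noteq> 0 \<Longrightarrow> base_values ! x \<le> 8"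
proof -
  have "\<forall>x\<in>set [0..<32].
    (base_values ! x = base_values ! 2 \<longrightarrow> x = 2) \<and>
    (base_values ! x = base_values ! 12 \<longrightarrow> x = 12) \<and>
    (base_values ! x = base_values ! 1 \<longrightarrow> base_values ! xor x 2 = base_values ! xor 1 2 \<longrightarrow>
      base_values ! xor x 12 = base_values ! xor 1 12 \<longrightarrow> x = 1) \<and>
    (x \<noteq> 0 \<longrightarrow> base_values ! x \<le> 8)"
    unfolding base_values_def by code_simp
  moreover have "x \<in> set [0..<32]"
    using assms by simp
  ultimately show "base_values ! x = base_values ! 2 \<Longrightarrow> x = 2"
    and "base_values ! x = base_values ! 12 \<Longrightarrow> x = 12"
    and "base_values ! x = base_values ! 1 \<Longrightarrow> base_values ! (xor x 2) = base_values ! xor 1 2 \<Longrightarrow>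
      base_values ! xor x 12 = base_values ! xor 1 12 \<Longrightarrow> x = 1"
    and "x \<noteq> 0 \<Longrightarrow> base_values ! x \<le> 8"
    by blast+
qed

lemma base_values_inj:
  "inj_on (\<lambda>x. (base_values ! x, base_values ! xor x 2, base_values ! xor x 12, base_values ! xor x 1))
     {..<32}"
proof -
  have "distinct (map (\<lambda>x. (base_values ! x, base_values ! xor x 2, base_values ! xor x 12,
    base_values ! xor x 1)) [0..<32])"
    unfolding base_values_def by code_simp
  then show ?thesis
    unfolding distinct_map by (simp add: atLeast0LessThan)
qed

lemma rigid_base_set: "rigid 5 base_set"
proof (rule rigidI)
  fix \<pi> :: "nat \<Rightarrow> nat" and g :: nat
  assume bij: "bij_betw \<pi> {..<2 ^ 5} {..<2 ^ 5}" and "\<pi> 0 = 0" and "g < 2 ^ 5"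
    and inv: "\<And>g h. g < 2 ^ 5 \<Longrightarrow> h < 2 ^ 5 \<Longrightarrow>
      char_sum base_set (xor (\<pi> g) (\<pi> h)) = char_sum base_set (xor g h)"
  have less: "\<pi> x < 32" if "x < 32" for x
    using bij that by (auto simp: bij_betw_def)
  \<comment> \<open>Each fixed point \<open>c\<close> makes the value at the difference to
    \<open>c\<close> an invariant. Thus \<open>0\<close> yields \<open>2\<close> and
    \<open>12\<close>, these yield \<open>1\<close>, and the four together yield every
    \<open>g\<close>.\<close>
  have fix': "base_values ! xor (\<pi> x) c = base_values ! xor x c"
    if "\<pi> c = c" "c < 32" "x < 32" for x c
    using inv [of x c] that less [of x] xor_less_power_2 [of _ 5 c]
    by (simp add: char_sum_base_set)
  have fix_0: "base_values ! \<pi> x = base_values ! x" if "x < 32" for x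
    using fix' [of 0 x] that \<open>\<pi> 0 = 0\<close> by simp
  have 2: "\<pi> 2 = 2"
    by (rule base_values_unique(1)) (use fix_0 less in auto)
  have 12: "\<pi> 12 = 12"
    by (rule base_values_unique(2)) (use fix_0 less in auto)
  have 1: "\<pi> 1 = 1"
    by (rule base_values_unique(3)) (use fix_0 less fix' [OF 2] fix' [OF 12] in auto)
  show "\<pi> g = g"
    by (rule inj_onD [OF base_values_inj])
      (use \<open>g < 2 ^ 5\<close> fix_0 less fix' [OF 2] fix' [OF 12] fix' [OF 1] in auto)
qed

section \<open>Complements and prisms\<close>

text \<open>By orthogonality the two character sums add up to \<open>0\<close> at every nonzero
  element. A bijection preserves which differences are \<open>0\<close>, so it preserves both
  kernels or neither.\<close>

lemma rigid_Compl:
  assumes "S \<subseteq> {..<2 ^ n}"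
  shows "rigid n ({..<2 ^ n} - S) \<longleftrightarrow> rigid n S"
proof -
  have *: "char_sum ({..<2 ^ n} - S) g = (if g = 0 then 2 ^ n else 0) - char_sum S g"
    if "g < 2 ^ n" for g
    using sum_diff [OF finite_lessThan assms, of "\<lambda>c. chi c g"] sum_chi [OF that]
    by (simp add: char_sum_def)
  have "char_sum ({..<2 ^ n} - S) (xor (\<pi> g) (\<pi> h)) = char_sum ({..<2 ^ n} - S) (xor g h) \<longleftrightarrow>
      char_sum S (xor (\<pi> g) (\<pi> h)) = char_sum S (xor g h)"
    if "bij_betw \<pi> {..<2 ^ n} {..<2 ^ n}" "g < 2 ^ n" "h < 2 ^ n" for \<pi> g h
  proof -
    have "\<pi> g < 2 ^ n" "\<pi> h < 2 ^ n" "\<pi> g = \<pi> h \<longleftrightarrow> g = h"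
      using that by (auto simp: bij_betw_def inj_on_eq_iff)
    then show ?thesis
      using that by (auto simp: * xor_less_power_2 xor_eq_0_iff)
  qed
  then show ?thesis
    unfolding rigid_def by (intro arg_cong [where f = All] ext) metis
qed

lemma char_sum_insert_0:
  assumes "finite S" "0 \<notin> S"
  shows "char_sum (insert 0 S) g = 1 + char_sum S g"
  using assms by (simp add: char_sum_def)

text \<open>The trivial character only adds a constant to the kernel.\<close>

lemma rigid_insert_0:
  assumes "finite S"
  shows "rigid n (insert 0 S) \<longleftrightarrow> rigid n S"
  by (cases "0 \<in> S") (simp_all add: rigid_def char_sum_insert_0 assms insert_absorb)

text \<open>The doubled characters ignore the lowest bit, and the new character \<open>1\<close>
  reads just that bit.\<close>

lemma char_sum_prism:
  assumes "finite S"
  shows "char_sum (insert 1 ((*) 2 ` S)) g = (if odd g then - 1 else 1) + char_sum S (g div 2)"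
proof -
  have "1 \<notin> (*) 2 ` S" by (auto simp: image_iff)
  moreover have "inj_on ((*) (2::nat)) S" by (simp add: inj_on_def)
  ultimately show ?thesis
    using assms by (simp add: char_sum_def sum.reindex chi_double chi_Suc_0)
qed

text \<open>By the gap, \<open>1\<close> is the only nonzero element that is negated by exactly one character of the
  prism, so a symmetry respects the pairs \<open>{g, xor g 1}\<close> and acts on them as a symmetry of the
  base.\<close>

lemma rigid_prism:
  assumes rigid: "rigid n S" and fin: "finite S"
    and gap: "\<And>g. 0 < g \<Longrightarrow> g < 2 ^ n \<Longrightarrow> char_sum S g \<le> real (card S) - 4"
  shows "rigid (Suc n) (insert 1 ((*) 2 ` S))"
proof (rule rigidI)
  let ?k = "char_sum (insert 1 ((*) 2 ` S))"
  fix \<pi> :: "nat \<Rightarrow> nat" and g :: nat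
  assume bij: "bij_betw \<pi> {..<2 ^ Suc n} {..<2 ^ Suc n}" and \<pi>0: "\<pi> 0 = 0" and g: "g < 2 ^ Suc n"
    and inv: "\<And>g h. g < 2 ^ Suc n \<Longrightarrow> h < 2 ^ Suc n \<Longrightarrow> ?k (xor (\<pi> g) (\<pi> h)) = ?k (xor g h)"
  have k: "?k x = (if odd x then - 1 else 1) + char_sum S (x div 2)" for x
    using fin by (rule char_sum_prism)
  have one: "(1::nat) < 2 ^ Suc n" by (rule one_less_power) auto
  have less: "\<pi> x < 2 ^ Suc n" if "x < 2 ^ Suc n" for x
    using bij that by (auto simp: bij_betw_def)
  have inj: "\<pi> x = \<pi> y \<longleftrightarrow> x = y" if "x < 2 ^ Suc n" "y < 2 ^ Suc n" for x y
    using bij that by (auto simp: bij_betw_def inj_on_eq_iff)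
  \<comment> \<open>If \<open>x div 2\<close> is nonzero, \<open>gap\<close> bounds the value at
    \<open>x\<close> by \<open>card S - 3\<close>, while the value at \<open>1\<close> is
    \<open>card S - 1\<close>.\<close>
  have unique: "x = 1" if "x < 2 ^ Suc n" "x \<noteq> 0" "?k x = ?k 1" for x
  proof (rule ccontr)
    assume "x \<noteq> 1"
    with that have "0 < x div 2" "x div 2 < 2 ^ n" by auto
    then have "?k x \<le> real (card S) - 3"
      using gap [of "x div 2"] k [of x] by (simp split: if_splits)
    moreover have "?k 1 = real (card S) - 1"
      unfolding k by (simp add: char_sum_0)
    ultimately show False
      using that(3) by simp
  qed
  have flip: "\<pi> (xor x 1) = xor (\<pi> x) 1" if "x < 2 ^ Suc n" for x
  proof -
    have x': "xor x 1 < 2 ^ Suc n" using that one by (intro xor_less_power_2) auto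
    have "xor (\<pi> x) (\<pi> (xor x 1)) = 1"
    proof (rule unique)
      show "xor (\<pi> x) (\<pi> (xor x 1)) < 2 ^ Suc n"
        using that x' less by (intro xor_less_power_2) auto
      have "x \<noteq> xor x 1"
        by (metis xor_eq_0_iff xor_cancel zero_neq_one)
      then show "xor (\<pi> x) (\<pi> (xor x 1)) \<noteq> 0"
        using that x' by (simp only: xor_eq_0_iff inj) simp
      show "?k (xor (\<pi> x) (\<pi> (xor x 1))) = ?k 1"
        using inv [OF that x'] by (simp only: xor_cancel)
    qed
    then show ?thesis by (metis xor_cancel)
  qed
  have div2_eq: "\<pi> x div 2 = \<pi> y div 2" if "x < 2 ^ Suc n" "y < 2 ^ Suc n" "x div 2 = y div 2" for x y
  proof -
    have "y = x \<or> y = xor x 1"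
    proof -
      have "xor x y div 2 = 0" using that by (simp add: xor_nat_div_2)
      then have "xor x y = 0 \<or> xor x y = 1" by auto
      then show ?thesis by (metis xor_cancel xor_eq_0_iff)
    qed
    then show ?thesis using flip [OF that(1)] by (auto simp: xor_nat_div_2)
  qed
  \<comment> \<open>Adding the invariance for \<open>y\<close> and for \<open>xor y 1\<close>
    cancels the contributions of the lowest bit and leaves twice the sum over
    \<open>S\<close>.\<close>
  have inv_S: "char_sum S (xor (\<pi> x div 2) (\<pi> y div 2)) = char_sum S (xor (x div 2) (y div 2))"
    if "x < 2 ^ Suc n" "y < 2 ^ Suc n" for x y
  proof -
    have "xor y 1 < 2 ^ Suc n" using that one by (intro xor_less_power_2) auto
    from inv [OF that] inv [OF that(1) this] have
      "?k (xor (\<pi> x) (\<pi> y)) + ?k (xor (\<pi> x) (xor (\<pi> y) 1)) = ?k (xor x y) + ?k (xor x (xor y 1))"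
      by (simp only: flip [OF that(2)])
    then show ?thesis
      unfolding k by (simp add: xor_nat_div_2 even_xor_iff split: if_splits)
  qed
  \<comment> \<open>The permutation that \<open>\<pi>\<close> induces on the pairs, each pair being
    named by the common half of its members.\<close>
  define \<rho> where "\<rho> x = \<pi> (2 * x) div 2" for x
  have "\<rho> x = x" if "x < 2 ^ n" for x
  proof (rule rigidD [OF rigid _ _ _ that])
    show "\<rho> 0 = 0" by (simp add: \<rho>_def \<pi>0)
    show "char_sum S (xor (\<rho> g) (\<rho> h)) = char_sum S (xor g h)" if "g < 2 ^ n" "h < 2 ^ n" for g h
      using inv_S [of "2 * g" "2 * h"] that by (simp add: \<rho>_def)
    have "\<rho> ` {..<2 ^ n} = {..<2 ^ n}"
    proof
      show "\<rho> ` {..<2 ^ n} \<subseteq> {..<2 ^ n}"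
      proof
        fix y assume "y \<in> \<rho> ` {..<2 ^ n}"
        then obtain x where x: "x < 2 ^ n" "y = \<pi> (2 * x) div 2" by (auto simp: \<rho>_def)
        then have "\<pi> (2 * x) < 2 * 2 ^ n" using less [of "2 * x"] by simp
        with x show "y \<in> {..<2 ^ n}" by (simp add: less_mult_imp_div_less)
      qed
      show "{..<2 ^ n} \<subseteq> \<rho> ` {..<2 ^ n}"
      proof
        fix y :: nat assume "y \<in> {..<2 ^ n}"
        then have "2 * y \<in> \<pi> ` {..<2 ^ Suc n}" using bij by (auto simp: bij_betw_def)
        then obtain x where x: "x < 2 ^ Suc n" "\<pi> x = 2 * y" by auto
        then have "\<pi> (2 * (x div 2)) div 2 = \<pi> x div 2" by (intro div2_eq) auto
        with x show "y \<in> \<rho> ` {..<2 ^ n}" by (auto simp: \<rho>_def image_iff intro!: bexI [of _ "x div 2"])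
      qed
    qed
    then show "bij_betw \<rho> {..<2 ^ n} {..<2 ^ n}"
      unfolding bij_betw_def by (simp add: eq_card_imp_inj_on)
  qed
  then have "\<pi> (2 * (g div 2)) div 2 = g div 2"
    using g by (simp add: \<rho>_def)
  moreover have "\<pi> g div 2 = \<pi> (2 * (g div 2)) div 2"
    using g by (intro div2_eq) auto
  ultimately have d: "\<pi> g div 2 = g div 2" by simp
  \<comment> \<open>Comparison with the fixed point \<open>0\<close> recovers the lowest
    bit.\<close>
  have "?k (\<pi> g) = ?k g" using inv [of g 0] g \<pi>0 by simp
  with d have "odd (\<pi> g) \<longleftrightarrow> odd g" unfolding k by (simp split: if_splits)
  with d show "\<pi> g = g"
    by (metis div_mult_mod_eq parity_cases)
qed

text \<open>An invariant for the induction on \<open>n\<close>. The last clause says that at least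
  two characters in \<open>S\<close> negate \<open>g\<close>. The upper bound on
  \<open>card S\<close> yields this clause for the next set, and the lower bound yields the next
  upper bound.\<close>

definition extensible :: "nat \<Rightarrow> nat set \<Rightarrow> bool" where
  "extensible n S \<longleftrightarrow> S \<subseteq> {..<2 ^ n} \<and> rigid n S \<and> 2 \<le> card S \<and> card S + 3 \<le> 2 ^ n \<and>
     (\<forall>g. 0 < g \<longrightarrow> g < 2 ^ n \<longrightarrow> char_sum S g \<le> real (card S) - 4)"

lemma extensible_base_set: "extensible 5 base_set"
proof -
  have "card base_set = 12"
    by (simp add: base_set_def)
  moreover have "base_set \<subseteq> {..<2 ^ 5}"
    by (simp add: base_set_def)
  moreover have "char_sum base_set g \<le> 8" if "0 < g" "g < 2 ^ 5" for g
    using base_values_unique(4) [of g] that by (simp add: char_sum_base_set)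
  ultimately show ?thesis
    by (simp add: extensible_def rigid_base_set)
qed

text \<open>The prism alone violates the gap at \<open>1\<close>, which a single character negates.
  The complement stays rigid and has the negated sums away from \<open>0\<close>, so the trivial
  bound \<open>char_sum_ge\<close> gives the gap back.\<close>

lemma extensible_Suc:
  assumes "extensible n S"
  shows "extensible (Suc n) ({..<2 ^ Suc n} - insert 1 ((*) 2 ` S))"
proof -
  let ?T = "insert 1 ((*) 2 ` S)" and ?U = "{..<2 ^ Suc n} - insert 1 ((*) 2 ` S)"
  have S: "S \<subseteq> {..<2 ^ n}" "rigid n S" "2 \<le> card S" "card S + 3 \<le> 2 ^ n"
    and gap: "\<And>g. 0 < g \<Longrightarrow> g < 2 ^ n \<Longrightarrow> char_sum S g \<le> real (card S) - 4"
    using assms by (auto simp: extensible_def)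
  have fin: "finite S" using S(1) finite_subset by blast
  have "(1::nat) < 2 ^ Suc n" by (rule one_less_power) auto
  then have T: "?T \<subseteq> {..<2 ^ Suc n}" using S(1) by (auto simp: subset_eq)
  have "1 \<notin> (*) 2 ` S" by (auto simp: image_iff)
  moreover have "inj_on ((*) (2::nat)) S" by (simp add: inj_on_def)
  ultimately have "card ?T = card S + 1"
    using fin by (simp add: card_image)
  then have card: "card ?U + card S + 1 = 2 ^ Suc n"
    using T S(4) card_Diff_subset [of ?T "{..<2 ^ Suc n}"] fin by simp
  have "rigid (Suc n) ?U"
    unfolding rigid_Compl [OF T] using S(2) fin gap by (rule rigid_prism)
  moreover have "char_sum ?U g \<le> real (card ?U) - 4" if "0 < g" "g < 2 ^ Suc n" for g
  proof -
    have "char_sum ?U g + char_sum ?T g = 0"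
      using sum.subset_diff [OF T, of "\<lambda>c. chi c g"] sum_chi [OF that(2)] that(1)
      by (simp add: char_sum_def)
    then have "char_sum ?U g \<le> real (card S) + 1"
      using char_sum_prism [OF fin, of g] char_sum_ge [of S "g div 2"] by (simp split: if_splits)
    moreover have "card S + 5 \<le> card ?U" using card S(4) by simp
    ultimately show ?thesis by linarith
  qed
  moreover have "2 \<le> card ?U"
    using card S(3,4) unfolding power_Suc by linarith
  moreover have "card ?U + 3 \<le> 2 ^ Suc n"
    using card S(3) by linarith
  ultimately show ?thesis
    unfolding extensible_def by blast
qed

lemma exists_extensible:
  assumes "5 \<le> n"
  shows "\<exists>S. extensible n S"
  using assms by (induction n rule: dec_induct) (use extensible_base_set extensible_Suc in blast)+

text \<open>The trivial character is included so that the coefficients given by the kernel sum to 1.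
  The last property makes the block representation faithful; for \<open>5 \<le> n\<close> it follows
  from the gap.\<close>

lemma exists_rigid:
  assumes "n \<notin> {2, 3, 4}"
  shows "\<exists>S\<subseteq>{..<2 ^ n}. rigid n S \<and> 0 \<in> S \<and> (\<forall>g. 0 < g \<longrightarrow> g < 2 ^ n \<longrightarrow> (\<exists>c\<in>S. chi c g = - 1))"
proof (cases "5 \<le> n")
  case True
  then obtain S where "extensible n S" using exists_extensible by blast
  then have S: "S \<subseteq> {..<2 ^ n}" "rigid n S"
    and gap: "\<And>g. 0 < g \<Longrightarrow> g < 2 ^ n \<Longrightarrow> char_sum S g \<le> real (card S) - 4"
    by (auto simp: extensible_def)
  have fin: "finite S" using S(1) finite_subset by blast
  have "\<exists>c\<in>S. chi c g = - 1" if "0 < g" "g < 2 ^ n" for g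
  proof (rule ccontr)
    assume "\<not> (\<exists>c\<in>S. chi c g = - 1)"
    then have "\<forall>c\<in>S. chi c g = 1"
      using chi_cases by blast
    then have "char_sum S g = real (card S)"
      by (simp add: char_sum_def)
    with gap [OF that] show False by simp
  qed
  with S fin show ?thesis
    by (intro exI [of _ "insert 0 S"]) (auto simp: rigid_insert_0)
next
  case False
  with assms consider "n = 0" | "n = 1"
    by fastforce
  then show ?thesis
  proof cases
    case 1
    then show ?thesis by (intro exI [of _ "{0}"] conjI) (auto intro!: rigidI)
  next
    case 2
    have "rigid n {0, 1}"
    proof (rule rigidI)
      fix \<pi> :: "nat \<Rightarrow> nat" and g :: nat
      assume "bij_betw \<pi> {..<2 ^ n} {..<2 ^ n}" "\<pi> 0 = 0" "g < 2 ^ n"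
      with 2 have "inj_on \<pi> {..<2}" "\<pi> ` {..<2} = {..<2}" "g = 0 \<or> g = 1"
        by (auto simp: bij_betw_def)
      then have "\<pi> 1 \<in> {..<2}" "\<pi> 1 \<noteq> \<pi> 0"
        using inj_onD [of \<pi> "{..<2}" 1 0] by auto
      then show "\<pi> g = g"
        using \<open>\<pi> 0 = 0\<close> \<open>g = 0 \<or> g = 1\<close> by auto
    qed
    moreover have "\<exists>c\<in>{0, 1}. chi c g = - 1" if "0 < g" "g < 2 ^ n" for g
    proof -
      have "g = 1" using that 2 by simp
      then show ?thesis by (simp add: chi.simps)
    qed
    ultimately show ?thesis using 2
      by (intro exI [of _ "{0, 1}"]) simp
  qed
qed

section \<open>Coordinates on the group\<close>

text \<open>An embedding with \<open>n\<close> maximal is onto, since an element outside its image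
  would provide one more bit.\<close>

lemma elementary_abelian_2_group_coordinates:
  fixes G :: "('a, 'b) monoid_scheme"
  assumes G: "elementary_abelian_2_group G" and fin: "finite (carrier G)"
  obtains n and \<phi> :: "nat \<Rightarrow> 'a" where "bij_betw \<phi> {..<2 ^ n} (carrier G)"
    and "\<And>a b. a < 2 ^ n \<Longrightarrow> b < 2 ^ n \<Longrightarrow> \<phi> (xor a b) = \<phi> a \<otimes>\<^bsub>G\<^esub> \<phi> b"
proof -
  interpret comm_group G
    using G by (simp add: elementary_abelian_2_group_def)
  have square: "x \<otimes>\<^bsub>G\<^esub> x = \<one>\<^bsub>G\<^esub>" if "x \<in> carrier G" for x
    using G that by (simp add: elementary_abelian_2_group_def)
  define emb where "emb n \<phi> \<longleftrightarrow> \<phi> ` {..<2 ^ n} \<subseteq> carrier G \<and> inj_on \<phi> {..<2 ^ n} \<and>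
    (\<forall>a<2 ^ n. \<forall>b<2 ^ n. \<phi> (xor a b) = \<phi> a \<otimes>\<^bsub>G\<^esub> \<phi> b)" for n and \<phi> :: "nat \<Rightarrow> 'a"
  have "\<exists>\<phi>. emb 0 \<phi>"
    by (intro exI [of _ "\<lambda>_. \<one>\<^bsub>G\<^esub>"]) (auto simp: emb_def lessThan_Suc)
  moreover have "n \<le> card (carrier G)" if "\<exists>\<phi>. emb n \<phi>" for n
  proof -
    have "2 ^ n \<le> card (carrier G)"
      using that fin card_inj_on_le [of _ "{..<2 ^ n :: nat}"] by (fastforce simp: emb_def)
    then show ?thesis
      using less_exp [of n] by linarith
  qed
  ultimately obtain n where "\<exists>\<phi>. emb n \<phi>" and max: "\<And>m. \<exists>\<phi>. emb m \<phi> \<Longrightarrow> m \<le> n"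
    using Nat.ex_has_greatest_nat [of "\<lambda>n. \<exists>\<phi>. emb n \<phi>" 0 "card (carrier G)"] by blast
  then obtain \<phi> where \<phi>: "emb n \<phi>" by blast
  then have closed: "\<phi> a \<in> carrier G" if "a < 2 ^ n" for a
    using that by (auto simp: emb_def)
  have hom: "\<phi> (xor a b) = \<phi> a \<otimes>\<^bsub>G\<^esub> \<phi> b" if "a < 2 ^ n" "b < 2 ^ n" for a b
    using \<phi> that by (simp add: emb_def)
  have inj: "inj_on \<phi> {..<2 ^ n}"
    using \<phi> by (simp add: emb_def)
  have "\<phi> ` {..<2 ^ n} = carrier G"
  proof (rule ccontr)
    assume "\<phi> ` {..<2 ^ n} \<noteq> carrier G"
    then obtain x where x: "x \<in> carrier G" "x \<notin> \<phi> ` {..<2 ^ n}"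
      using closed by blast
    have zero: "\<phi> 0 = \<one>\<^bsub>G\<^esub>"
      using hom [of 0 0] closed [of 0] square [of "\<phi> 0"] by simp
    \<comment> \<open>The lowest bit is the exponent of the new element \<open>x\<close>, and the
      remaining bits are mapped by \<open>\<phi>\<close>.\<close>
    define \<psi> where "\<psi> a = \<phi> (a div 2) \<otimes>\<^bsub>G\<^esub> (if odd a then x else \<one>\<^bsub>G\<^esub>)" for a
    have half: "a div 2 < 2 ^ n" if "a < 2 ^ Suc n" for a :: nat
      using that by (auto simp: less_mult_imp_div_less)
    have \<psi>_closed: "\<psi> a \<in> carrier G" if "a < 2 ^ Suc n" for a
      using closed half [OF that] x by (simp add: \<psi>_def)
    have \<psi>_hom: "\<psi> (xor a b) = \<psi> a \<otimes>\<^bsub>G\<^esub> \<psi> b" if "a < 2 ^ Suc n" "b < 2 ^ Suc n" for a b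
      using hom closed half [OF that(1)] half [OF that(2)] x(1) square [OF x(1)]
      by (auto simp: \<psi>_def xor_nat_div_2 even_xor_iff m_ac)
    have "a = 0" if a: "a < 2 ^ Suc n" "\<psi> a = \<one>\<^bsub>G\<^esub>" for a
    proof (cases "odd a")
      case True
      \<comment> \<open>Elements are their own inverses, so cancellation would put \<open>x\<close>
        into the image of \<open>\<phi>\<close>.\<close>
      with a have "\<phi> (a div 2) \<otimes>\<^bsub>G\<^esub> x = \<phi> (a div 2) \<otimes>\<^bsub>G\<^esub> \<phi> (a div 2)"
        using square closed half [OF a(1)] by (simp add: \<psi>_def)
      then have "x = \<phi> (a div 2)"
        using closed half [OF a(1)] x(1) by simp
      then show ?thesis
        using x(2) half [OF a(1)] by blast
    next
      case False
      with a have "\<phi> (a div 2) = \<phi> 0"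
        using closed half [OF a(1)] by (simp add: \<psi>_def zero)
      then have "a div 2 = 0"
        using inj half [OF a(1)] by (auto simp: inj_on_eq_iff)
      with False show ?thesis by auto
    qed
    then have "inj_on \<psi> {..<2 ^ Suc n}"
      using square \<psi>_closed \<psi>_hom xor_less_power_2 [of _ "Suc n"] xor_eq_0_iff
      by (intro inj_onI) (metis lessThan_iff)
    then have "emb (Suc n) \<psi>"
      using \<psi>_closed \<psi>_hom by (auto simp: emb_def)
    then show False
      using max [of "Suc n"] by auto
  qed
  then show thesis
    using that [of \<phi> n] inj hom by (simp add: bij_betw_def)
qed

section \<open>Affine maps of polytopes of matrices\<close>

lemma mat_convexD:
  assumes "mat_convex d S" "A \<in> S" "B \<in> S" "0 \<le> u" "0 \<le> v" "u + v = 1"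
  shows "u \<cdot>\<^sub>m A + v \<cdot>\<^sub>m B \<in> S"
  using assms by (simp add: mat_convex_def)

text \<open>The intersection defining the hull stays inside \<open>carrier_mat d d\<close> because
  that space is itself convex and contains \<open>X\<close>.\<close>

lemma mat_convex_hull:
  assumes "X \<subseteq> carrier_mat d d"
  shows "mat_convex d (mat_convex d hull X)"
proof -
  have "mat_convex d (carrier_mat d d)"
    by (simp add: mat_convex_def)
  then have "mat_convex d hull X \<subseteq> carrier_mat d d"
    using assms by (intro hull_minimal)
  then show ?thesis
    by (auto simp: mat_convex_def hull_def)
qed

lemma mat_convex_hull_carrier:
  assumes "X \<subseteq> carrier_mat d d" "A \<in> mat_convex d hull X"
  shows "A \<in> carrier_mat d d"
  using mat_convex_hull [OF assms(1)] assms(2) by (auto simp: mat_convex_def)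

text \<open>The points of the hull satisfying \<open>Q\<close> form a convex set containing
  \<open>X\<close>.\<close>

lemma mat_convex_hull_induct [consumes 2, case_names base combination]:
  assumes "A \<in> mat_convex d hull X" "X \<subseteq> carrier_mat d d"
    and "\<And>A. A \<in> X \<Longrightarrow> Q A"
    and "\<And>A B u v. \<lbrakk>A \<in> mat_convex d hull X; B \<in> mat_convex d hull X; Q A; Q B;
      0 \<le> u; 0 \<le> v; u + v = 1\<rbrakk> \<Longrightarrow> Q (u \<cdot>\<^sub>m A + v \<cdot>\<^sub>m B)"
  shows "Q A"
proof -
  define H where "H = mat_convex d hull X"
  have "mat_convex d {A \<in> H. Q A}"
    using mat_convexD [OF mat_convex_hull [OF assms(2)]] mat_convex_hull_carrier [OF assms(2)] assms(4)
    by (auto simp: mat_convex_def [of d "{A \<in> H. Q A}"] simp flip: H_def)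
  moreover have "X \<subseteq> {A \<in> H. Q A}"
    using assms(3) by (auto simp: H_def hull_inc)
  ultimately have "H \<subseteq> {A \<in> H. Q A}"
    unfolding H_def by (intro hull_minimal)
  then show ?thesis
    using assms(1) by (auto simp flip: H_def)
qed

text \<open>The linear part passes through any finite combination, the translation \<open>T\<close>
  because the coefficients sum to 1. They may be negative, as kernel values can be.\<close>

lemma mat_affine_map_sum:
  assumes f: "mat_affine_map d f" and A: "\<And>g. g \<in> I \<Longrightarrow> A g \<in> carrier_mat d d"
    and I: "finite I" "sum x I = 1"
  shows "f (mat d d (\<lambda>ij. \<Sum>g\<in>I. x g * A g $$ ij)) = mat d d (\<lambda>ij. \<Sum>g\<in>I. x g * f (A g) $$ ij)"
proof -
  from f obtain L T where T: "T \<in> carrier_mat d d" and L: "mat_linear_map d L"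
    and f_eq: "\<And>A. A \<in> carrier_mat d d \<Longrightarrow> f A = L A + T"
    by (auto simp: mat_affine_map_def)
  have L_carrier: "L B \<in> carrier_mat d d" if "B \<in> carrier_mat d d" for B
    using L that by (auto simp: mat_linear_map_def Pi_iff)
  have L_sum: "L (mat d d (\<lambda>ij. \<Sum>g\<in>J. x g * A g $$ ij)) = mat d d (\<lambda>ij. \<Sum>g\<in>J. x g * L (A g) $$ ij)"
    if "finite J" "J \<subseteq> I" for J
    using that
  proof (induction J rule: finite_induct)
    case empty
    have "L (0 \<cdot>\<^sub>m 0\<^sub>m d d) = 0 \<cdot>\<^sub>m L (0\<^sub>m d d)"
      using L zero_carrier_mat unfolding mat_linear_map_def by blast
    moreover have "(0::real) \<cdot>\<^sub>m 0\<^sub>m d d = mat d d (\<lambda>ij. \<Sum>g\<in>{}. x g * A g $$ ij)"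
      by auto
    moreover have "(0::real) \<cdot>\<^sub>m L (0\<^sub>m d d) = mat d d (\<lambda>ij. \<Sum>g\<in>{}. x g * L (A g) $$ ij)"
      using L_carrier [of "0\<^sub>m d d"] by auto
    ultimately show ?case by simp
  next
    case (insert g J)
    have g: "A g \<in> carrier_mat d d" using A insert.prems by auto
    have "mat d d (\<lambda>ij. \<Sum>g\<in>insert g J. x g * A g $$ ij) =
        x g \<cdot>\<^sub>m A g + mat d d (\<lambda>ij. \<Sum>g\<in>J. x g * A g $$ ij)"
      using g insert.hyps by auto
    also have "L \<dots> = x g \<cdot>\<^sub>m L (A g) + L (mat d d (\<lambda>ij. \<Sum>g\<in>J. x g * A g $$ ij))"
      using L g by (simp add: mat_linear_map_def)
    also have "\<dots> = mat d d (\<lambda>ij. \<Sum>g\<in>insert g J. x g * L (A g) $$ ij)"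
      using L_carrier [OF g] insert by auto
    finally show ?case .
  qed
  have "f (mat d d (\<lambda>ij. \<Sum>g\<in>I. x g * A g $$ ij)) = mat d d (\<lambda>ij. \<Sum>g\<in>I. x g * L (A g) $$ ij) + T"
    by (simp add: f_eq L_sum I)
  also have "\<dots> = mat d d (\<lambda>ij. \<Sum>g\<in>I. x g * f (A g) $$ ij)"
  proof (rule eq_matI)
    fix i j assume "i < dim_row (mat d d (\<lambda>ij. \<Sum>g\<in>I. x g * f (A g) $$ ij))"
      "j < dim_col (mat d d (\<lambda>ij. \<Sum>g\<in>I. x g * f (A g) $$ ij))"
    then have ij: "i < d" "j < d" by auto
    have "f (A g) $$ (i, j) = L (A g) $$ (i, j) + T $$ (i, j)" if "g \<in> I" for g
      using f_eq [OF A [OF that]] L_carrier [OF A [OF that]] T ij by simp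
    then have "(\<Sum>g\<in>I. x g * f (A g) $$ (i, j)) =
        (\<Sum>g\<in>I. x g * L (A g) $$ (i, j)) + sum x I * T $$ (i, j)"
      by (simp add: distrib_left sum.distrib sum_distrib_right)
    then show "(mat d d (\<lambda>ij. \<Sum>g\<in>I. x g * L (A g) $$ ij) + T) $$ (i, j) =
        mat d d (\<lambda>ij. \<Sum>g\<in>I. x g * f (A g) $$ ij) $$ (i, j)"
      using ij T I by simp
  qed (use T in auto)
  finally show ?thesis .
qed

lemma mat_affine_map_combination:
  assumes f: "mat_affine_map d f" and "A \<in> carrier_mat d d" "B \<in> carrier_mat d d" and "u + v = 1"
  shows "f (u \<cdot>\<^sub>m A + v \<cdot>\<^sub>m B) = u \<cdot>\<^sub>m f A + v \<cdot>\<^sub>m f B"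
proof -
  have [simp]: "u * x + v * x = x" for x
    using assms(4) by (simp flip: distrib_right)
  from f obtain L T where T: "T \<in> carrier_mat d d" and L: "mat_linear_map d L"
    and f_eq: "\<And>A. A \<in> carrier_mat d d \<Longrightarrow> f A = L A + T"
    by (auto simp: mat_affine_map_def)
  have L_carrier: "L B \<in> carrier_mat d d" if "B \<in> carrier_mat d d" for B
    using L that by (auto simp: mat_linear_map_def Pi_iff)
  have "f (u \<cdot>\<^sub>m A + v \<cdot>\<^sub>m B) = (u \<cdot>\<^sub>m L A + v \<cdot>\<^sub>m L B) + T"
    using L assms(2,3) by (simp add: f_eq mat_linear_map_def)
  also have "\<dots> = u \<cdot>\<^sub>m f A + v \<cdot>\<^sub>m f B"
    using L_carrier [OF assms(2)] L_carrier [OF assms(3)] T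
    by (intro eq_matI) (auto simp: f_eq assms(2,3) algebra_simps)
  finally show ?thesis .
qed

lemma mat_affine_map_eq_on_hull:
  assumes "mat_affine_map d f" "mat_affine_map d f'" "X \<subseteq> carrier_mat d d"
    and "\<And>A. A \<in> X \<Longrightarrow> f A = f' A" and "A \<in> mat_convex d hull X"
  shows "f A = f' A"
  using assms(5,3)
  by (induction rule: mat_convex_hull_induct)
    (use assms mat_convex_hull_carrier in \<open>auto simp: mat_affine_map_combination\<close>)

lemma mat_affine_map_times:
  assumes "M \<in> carrier_mat d d"
  shows "mat_affine_map d (\<lambda>A. M * A)"
  unfolding mat_affine_map_def mat_linear_map_def
  using assms
  by (intro exI [of _ "\<lambda>A. M * A"] bexI [of _ "0\<^sub>m d d"])
    (auto simp: mult_add_distrib_mat mult_smult_distrib)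

text \<open>An affine bijection of a polytope permutes its extreme points, and a zero-one matrix is extreme
  in any polytope spanned by such matrices.\<close>

lemma affine_bij_hull_zero_one:
  assumes X: "X \<subseteq> carrier_mat d d"
    and zero_one: "\<And>A i j. A \<in> X \<Longrightarrow> i < d \<Longrightarrow> j < d \<Longrightarrow> A $$ (i, j) \<in> {0, 1}"
    and f: "mat_affine_map d f" and bij: "bij_betw f (mat_convex d hull X) (mat_convex d hull X)"
    and A: "A \<in> X"
  shows "f A \<in> X"
proof -
  let ?P = "mat_convex d hull X"
  note carrier = mat_convex_hull_carrier [OF X]
  have f_mem: "f B \<in> ?P" if "B \<in> ?P" for B
    using bij that by (auto simp: bij_betw_def)
  have AP: "A \<in> ?P"
    using A by (rule hull_inc)
  \<comment> \<open>The polytope lies in the unit cube, of which the members of \<open>X\<close> are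
    corners.\<close>
  have bounds: "0 \<le> B $$ (i, j) \<and> B $$ (i, j) \<le> 1" if "B \<in> ?P" "i < d" "j < d" for B i j
    using that(1) X
  proof (induction rule: mat_convex_hull_induct)
    case (base A)
    then show ?case using zero_one [of A i j] that by auto
  next
    case (combination A B u v)
    have "u * A $$ (i, j) + v * B $$ (i, j) \<le> u * 1 + v * 1"
      using combination by (intro add_mono mult_left_mono) auto
    then show ?case
      using combination that carrier [of A] carrier [of B] by simp
  qed
  \<comment> \<open>Points of the hull outside \<open>X\<close> are not extreme. In the induction, a
    degenerate combination collapses to \<open>C\<close> or \<open>D\<close>.\<close>
  have decompose: "B \<in> X \<or> (\<exists>C\<in>?P. \<exists>D\<in>?P. C \<noteq> D \<and> (\<exists>u>0. \<exists>v>0. u + v = 1 \<and> B = u \<cdot>\<^sub>m C + v \<cdot>\<^sub>m D))"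
    (is "?Q B") if "B \<in> ?P" for B
    using that X
  proof (induction rule: mat_convex_hull_induct)
    case (combination C D u v)
    note CD = carrier [OF combination(1)] carrier [OF combination(2)]
    show ?case
    proof (cases "u = 0 \<or> v = 0 \<or> C = D")
      case True
      have "u \<cdot>\<^sub>m C + v \<cdot>\<^sub>m C = C"
      proof (rule eq_matI)
        fix i j assume "i < dim_row C" "j < dim_col C"
        then have "(u \<cdot>\<^sub>m C + v \<cdot>\<^sub>m C) $$ (i, j) = (u + v) * C $$ (i, j)"
          using CD by (simp add: distrib_right)
        with combination(5) show "(u \<cdot>\<^sub>m C + v \<cdot>\<^sub>m C) $$ (i, j) = C $$ (i, j)" by simp
      qed (use CD in auto)
      moreover have "u = 0 \<Longrightarrow> u \<cdot>\<^sub>m C + v \<cdot>\<^sub>m D = D" "v = 0 \<Longrightarrow> u \<cdot>\<^sub>m C + v \<cdot>\<^sub>m D = C"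
        using CD combination(5) by (auto intro!: eq_matI)
      ultimately have "u \<cdot>\<^sub>m C + v \<cdot>\<^sub>m D = C \<or> u \<cdot>\<^sub>m C + v \<cdot>\<^sub>m D = D"
        using True by auto
      then show ?thesis
      proof
        assume eq: "u \<cdot>\<^sub>m C + v \<cdot>\<^sub>m D = C"
        show ?thesis unfolding eq by (rule combination(6))
      next
        assume eq: "u \<cdot>\<^sub>m C + v \<cdot>\<^sub>m D = D"
        show ?thesis unfolding eq by (rule combination(7))
      qed
    next
      case False
      then have "0 < u" "0 < v" using combination(3,4) by auto
      with False show ?thesis
        using combination(1,2,5) by (intro disjI2 bexI [of _ C] bexI [of _ D] conjI exI [of _ u] exI [of _ v]) auto
    qed
  qed simp
  show ?thesis
  proof (rule ccontr)
    assume "f A \<notin> X"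
    with decompose [OF f_mem [OF AP]] obtain C D u v where
      CD: "C \<in> ?P" "D \<in> ?P" "C \<noteq> D" and uv: "0 < u" "0 < v" "u + v = 1"
      and fA: "f A = u \<cdot>\<^sub>m C + v \<cdot>\<^sub>m D"
      by (elim disjE bexE conjE exE) simp_all
    have "C \<in> f ` ?P" "D \<in> f ` ?P"
      using CD bij by (simp_all add: bij_betw_def)
    then obtain C' D' where CD': "C' \<in> ?P" "D' \<in> ?P" "f C' = C" "f D' = D"
      by (elim imageE) simp
    \<comment> \<open>Pulled back through \<open>f\<close>, the decomposition makes \<open>A\<close>
      a proper combination of \<open>C'\<close> and \<open>D'\<close>. The entries of
      \<open>A\<close> are endpoints of the interval from 0 to 1, which forces
      \<open>C' = D'\<close>.\<close>
    let ?E = "u \<cdot>\<^sub>m C' + v \<cdot>\<^sub>m D'"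
    have "f ?E = f A"
      using mat_affine_map_combination [OF f carrier [OF CD'(1)] carrier [OF CD'(2)] uv(3)] CD' fA by simp
    moreover have "?E \<in> ?P"
      using mat_convexD [OF mat_convex_hull [OF X]] CD' uv by simp
    ultimately have E: "?E = A"
      using bij AP by (auto simp: bij_betw_def inj_on_def)
    have "C' = D'"
    proof (rule eq_matI)
      fix i j assume "i < dim_row D'" "j < dim_col D'"
      then have ij: "i < d" "j < d" using carrier [OF CD'(2)] by auto
      have eq: "u * C' $$ (i, j) + v * D' $$ (i, j) = A $$ (i, j)"
        unfolding E [symmetric] using carrier [OF CD'(1)] carrier [OF CD'(2)] ij by simp
      note b = bounds [OF CD'(1) ij] bounds [OF CD'(2) ij]
      consider "A $$ (i, j) = 0" | "A $$ (i, j) = 1"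
        using zero_one [OF A ij] by auto
      then show "C' $$ (i, j) = D' $$ (i, j)"
      proof cases
        case 1
        with eq have "u * C' $$ (i, j) + v * D' $$ (i, j) = 0" by simp
        then have "u * C' $$ (i, j) = 0 \<and> v * D' $$ (i, j) = 0"
          using b uv by (subst (asm) add_nonneg_eq_0_iff) auto
        with uv show ?thesis by simp
      next
        case 2
        then have "u * (1 - C' $$ (i, j)) + v * (1 - D' $$ (i, j)) = 0"
          using eq uv by (simp add: algebra_simps)
        then have "u * (1 - C' $$ (i, j)) = 0 \<and> v * (1 - D' $$ (i, j)) = 0"
          using b uv by (subst (asm) add_nonneg_eq_0_iff) auto
        with uv show ?thesis by simp
      qed
    qed (use carrier [OF CD'(1)] carrier [OF CD'(2)] in auto)
    with CD CD' show False by simp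
  qed
qed

section \<open>The block representation\<close>

text \<open>Divided by \<open>2 ^ n\<close>, the kernel reproduces the characters in
  \<open>S\<close>: orthogonality kills all terms except \<open>c' = c\<close>.\<close>

lemma sum_char_sum_chi:
  assumes S: "S \<subseteq> {..<2 ^ n}" and c: "c \<in> S"
  shows "(\<Sum>g<2 ^ n. char_sum S (xor g h) * chi c g) = 2 ^ n * chi c h"
proof -
  have fin: "finite S" using S finite_subset by blast
  have "(\<Sum>g<2 ^ n. char_sum S (xor g h) * chi c g) = (\<Sum>g<2 ^ n. \<Sum>c'\<in>S. chi c' h * chi g (xor c' c))"
    by (simp add: char_sum_def sum_distrib_left sum_distrib_right chi_xor_right chi_commute [of _ g for g] mult_ac)
  also have "\<dots> = (\<Sum>c'\<in>S. chi c' h * (\<Sum>g<2 ^ n. chi g (xor c' c)))"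
    unfolding sum_distrib_left by (rule sum.swap)
  also have "\<dots> = (\<Sum>c'\<in>S. if c' = c then 2 ^ n * chi c h else 0)"
  proof (rule sum.cong)
    fix c' assume "c' \<in> S"
    then have "xor c' c < 2 ^ n" using S c by (auto intro: xor_less_power_2)
    then show "chi c' h * (\<Sum>g<2 ^ n. chi g (xor c' c)) = (if c' = c then 2 ^ n * chi c h else 0)"
      by (simp add: sum_chi xor_eq_0_iff)
  qed simp
  also have "\<dots> = 2 ^ n * chi c h"
    using fin c by simp
  finally show ?thesis .
qed

text \<open>Let \<open>P\<close> be the orthogonal projection onto the span of \<open>S\<close> and \<open>Q\<close> its
  conjugate by \<open>\<sigma>\<close>.  The assumption \<open>span\<close> says \<open>P Q = Q\<close>, and since the traces
  of \<open>P\<close> and \<open>Q\<close> agree, \<open>P - Q\<close> has Frobenius norm zero.\<close>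

lemma char_sum_invariant:
  assumes S: "S \<subseteq> {..<2 ^ n}" and bij: "bij_betw \<sigma> {..<2 ^ n} {..<2 ^ n}"
    and span: "\<And>c h. c \<in> S \<Longrightarrow> h < 2 ^ n \<Longrightarrow>
      (\<Sum>g<2 ^ n. char_sum S (xor g h) * chi c (\<sigma> g)) = 2 ^ n * chi c (\<sigma> h)"
    and gh: "g < 2 ^ n" "h < 2 ^ n"
  shows "char_sum S (xor (\<sigma> g) (\<sigma> h)) = char_sum S (xor g h)"
proof -
  let ?V = "{..<2 ^ n :: nat}" and ?k = "char_sum S"
  have k_xor: "?k (xor x y) = (\<Sum>c\<in>S. chi c x * chi c y)" for x y
    by (simp add: char_sum_def chi_xor_right)
  \<comment> \<open>Up to scaling, a diagonal entry of the product of the kernel with its conjugate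
    by \<open>\<tau>\<close>; used for \<open>\<sigma>\<close> and for the identity.\<close>
  have *: "(\<Sum>g\<in>?V. ?k (xor g h) * ?k (xor (\<tau> g) (\<tau> h))) = 2 ^ n * real (card S)"
    if "\<And>c. c \<in> S \<Longrightarrow> (\<Sum>g\<in>?V. ?k (xor g h) * chi c (\<tau> g)) = 2 ^ n * chi c (\<tau> h)"
    for h and \<tau> :: "nat \<Rightarrow> nat"
  proof -
    have "(\<Sum>g\<in>?V. ?k (xor g h) * ?k (xor (\<tau> g) (\<tau> h))) =
        (\<Sum>g\<in>?V. \<Sum>c\<in>S. chi c (\<tau> h) * (?k (xor g h) * chi c (\<tau> g)))"
      by (simp add: k_xor [of "\<tau> _" "\<tau> _"] sum_distrib_left mult_ac)
    also have "\<dots> = (\<Sum>c\<in>S. chi c (\<tau> h) * (\<Sum>g\<in>?V. ?k (xor g h) * chi c (\<tau> g)))"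
      unfolding sum_distrib_left by (rule sum.swap)
    also have "\<dots> = (\<Sum>c\<in>S. 2 ^ n * (chi c (\<tau> h) * chi c (\<tau> h)))"
      by (intro sum.cong refl) (simp only: that mult.left_commute)
    finally show ?thesis by simp
  qed
  let ?M = "\<Sum>h\<in>?V. 2 ^ n * real (card S)"
  have cross: "(\<Sum>h\<in>?V. \<Sum>g\<in>?V. ?k (xor g h) * ?k (xor (\<sigma> g) (\<sigma> h))) = ?M"
    by (intro sum.cong) (simp_all add: * span)
  have plain: "(\<Sum>h\<in>?V. \<Sum>g\<in>?V. ?k (xor g h) * ?k (xor g h)) = ?M"
    using * [of _ "\<lambda>x. x"] by (intro sum.cong) (simp_all add: sum_char_sum_chi [OF S])
  \<comment> \<open>Reindexing both variables by the bijection \<open>\<sigma>\<close> shows that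
    conjugation keeps the norm.\<close>
  have "(\<Sum>h\<in>?V. \<Sum>g\<in>?V. ?k (xor (\<sigma> g) (\<sigma> h)) * ?k (xor (\<sigma> g) (\<sigma> h))) =
      (\<Sum>h\<in>?V. \<Sum>g\<in>?V. ?k (xor g (\<sigma> h)) * ?k (xor g (\<sigma> h)))"
    by (intro sum.cong sum.reindex_bij_betw [OF bij]) simp
  also have "\<dots> = ?M"
    unfolding plain [symmetric]
    by (rule sum.reindex_bij_betw [OF bij, of "\<lambda>h. \<Sum>g\<in>?V. ?k (xor g h) * ?k (xor g h)"])
  finally have image: "(\<Sum>h\<in>?V. \<Sum>g\<in>?V. ?k (xor (\<sigma> g) (\<sigma> h)) * ?k (xor (\<sigma> g) (\<sigma> h))) = ?M" .
  \<comment> \<open>Expanding the square gives \<open>?M + ?M - 2 * ?M\<close>.\<close>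
  have "(\<Sum>h\<in>?V. \<Sum>g\<in>?V. (?k (xor (\<sigma> g) (\<sigma> h)) - ?k (xor g h))\<^sup>2) =
      (\<Sum>h\<in>?V. \<Sum>g\<in>?V. ?k (xor (\<sigma> g) (\<sigma> h)) * ?k (xor (\<sigma> g) (\<sigma> h))) +
      (\<Sum>h\<in>?V. \<Sum>g\<in>?V. ?k (xor g h) * ?k (xor g h)) -
      2 * (\<Sum>h\<in>?V. \<Sum>g\<in>?V. ?k (xor g h) * ?k (xor (\<sigma> g) (\<sigma> h)))"
    unfolding sum_distrib_left sum.distrib [symmetric] sum_subtractf [symmetric]
    by (intro sum.cong refl) (simp add: power2_eq_square algebra_simps)
  also have "\<dots> = 0"
    unfolding cross plain image by simp
  finally have "(?k (xor (\<sigma> g) (\<sigma> h)) - ?k (xor g h))\<^sup>2 = 0"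
    using gh by (simp add: sum_nonneg_eq_0_iff sum_nonneg)
  then show ?thesis by simp
qed

section \<open>Permutation matrices and the block action\<close>

definition perm_mat :: "nat \<Rightarrow> (nat \<Rightarrow> nat) \<Rightarrow> real mat" where
  "perm_mat d p = mat d d (\<lambda>(i, j). if i = p j then 1 else 0)"

lemma perm_mat_carrier [simp]: "perm_mat d p \<in> carrier_mat d d"
  by (simp add: perm_mat_def)

lemma perm_mat_id: "perm_mat d id = 1\<^sub>m d"
  by (auto simp: perm_mat_def)

lemma perm_mat_times:
  assumes "q permutes {..<d}"
  shows "perm_mat d p * perm_mat d q = perm_mat d (p \<circ> q)"
proof (rule eq_matI)
  fix i j assume "i < dim_row (perm_mat d (p \<circ> q))" "j < dim_col (perm_mat d (p \<circ> q))"
  then have ij: "i < d" "j < d" by (auto simp: perm_mat_def)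
  then have "q j < d" using permutes_in_image [OF assms, of j] by simp
  have "(perm_mat d p * perm_mat d q) $$ (i, j) =
      (\<Sum>k<d. (if i = p k then 1 else 0) * (if k = q j then 1 else 0))"
    using ij by (simp add: perm_mat_def scalar_prod_def atLeast0LessThan)
  also have "\<dots> = (\<Sum>k<d. if k = q j then (if i = p k then 1 else 0) else 0)"
    by (intro sum.cong) auto
  also have "\<dots> = perm_mat d (p \<circ> q) $$ (i, j)"
    using ij \<open>q j < d\<close> by (simp add: perm_mat_def)
  finally show "(perm_mat d p * perm_mat d q) $$ (i, j) = perm_mat d (p \<circ> q) $$ (i, j)" .
qed (simp_all add: perm_mat_def)

text \<open>For each \<open>c \<in> S\<close>, the group acts on the two points \<open>2 * c\<close> and \<open>2 * c + 1\<close> through the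
  character \<open>chi c\<close>.\<close>

definition block_perm :: "nat set \<Rightarrow> nat \<Rightarrow> nat \<Rightarrow> nat" where
  "block_perm S g j = (if j div 2 \<in> S \<and> chi (j div 2) g = - 1 then xor j 1 else j)"

lemma block_perm_xor: "block_perm S (xor g h) = block_perm S g \<circ> block_perm S h"
proof
  fix j :: nat
  show "block_perm S (xor g h) j = (block_perm S g \<circ> block_perm S h) j"
    using chi_cases [of "j div 2" g] chi_cases [of "j div 2" h]
    by (auto simp: block_perm_def chi_xor_right xor_nat_div_2 xor.assoc)
qed

lemma block_perm_0: "block_perm S 0 = id"
  by (auto simp: block_perm_def)

lemma block_perm_involution: "block_perm S g (block_perm S g j) = j"
  using block_perm_xor [of S g g] by (simp add: block_perm_0 fun_eq_iff)

lemma block_perm_permutes: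
  assumes "S \<subseteq> {..<2 ^ n}"
  shows "block_perm S g permutes {..<2 ^ Suc n}"
proof -
  have "j div 2 < 2 ^ n \<Longrightarrow> j < 2 ^ Suc n" for j :: nat
    by simp
  then have "block_perm S g j = j" if "j \<notin> {..<2 ^ Suc n}" for j
    using assms that by (auto simp: block_perm_def)
  then show ?thesis
    unfolding permutes_def by (metis block_perm_involution)
qed

text \<open>The dimension leaves room for a pair of points for every character; pairs outside
  \<open>S\<close> are fixed and contribute constant entries.\<close>

definition block_rep :: "nat \<Rightarrow> nat set \<Rightarrow> nat \<Rightarrow> real mat" where
  "block_rep n S g = perm_mat (2 ^ Suc n) (block_perm S g)"

lemma block_rep_carrier [simp]: "block_rep n S g \<in> carrier_mat (2 ^ Suc n) (2 ^ Suc n)"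
  unfolding block_rep_def by (rule perm_mat_carrier)

lemma block_rep_0: "block_rep n S 0 = 1\<^sub>m (2 ^ Suc n)"
  unfolding block_rep_def by (simp only: block_perm_0 perm_mat_id)

lemma block_rep_xor:
  assumes "S \<subseteq> {..<2 ^ n}"
  shows "block_rep n S (xor g h) = block_rep n S g * block_rep n S h"
  unfolding block_rep_def perm_mat_times [OF block_perm_permutes [OF assms]] block_perm_xor ..

lemma block_rep_entry:
  assumes "i < 2 ^ Suc n" "j < 2 ^ Suc n"
  shows "block_rep n S g $$ (i, j) = (if i = block_perm S g j then 1 else 0)"
  unfolding block_rep_def perm_mat_def using assms by (simp del: power_Suc)

text \<open>An entry inside a block of \<open>S\<close> is half of 1 plus or minus the character.
  All other entries are constant, and for them the trivial character serves as \<open>c\<close>. So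
  entries lie in the span of \<open>S\<close>.\<close>

lemma block_rep_entry_affine:
  assumes "i < 2 ^ Suc n" "j < 2 ^ Suc n" "0 \<in> S"
  shows "\<exists>\<alpha> \<beta>. \<exists>c\<in>S. \<forall>g. block_rep n S g $$ (i, j) = \<alpha> + \<beta> * chi c g"
proof (cases "j div 2 \<in> S")
  case True
  have "xor j 1 \<noteq> j"
    by (metis xor_cancel xor_self_eq zero_neq_one)
  then have "block_rep n S g $$ (i, j) =
      (if i = j \<or> i = xor j 1 then 1 / 2 else 0) +
      (if i = j then 1 / 2 else if i = xor j 1 then - 1 / 2 else 0) * chi (j div 2) g" for g
    using True chi_cases [of "j div 2" g] unfolding block_rep_entry [OF assms(1,2)]
    by (auto simp: block_perm_def)
  with True show ?thesis by blast
next
  case False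
  then have "block_rep n S g $$ (i, j) = (if i = j then 1 else 0) + 0 * chi 0 g" for g
    unfolding block_rep_entry [OF assms(1,2)] by (simp add: block_perm_def)
  with assms(3) show ?thesis by blast
qed

text \<open>Conversely, a diagonal entry of its block recovers each character in
  \<open>S\<close>.\<close>

lemma chi_eq_block_rep_entry:
  assumes "S \<subseteq> {..<2 ^ n}" "c \<in> S"
  shows "chi c g = 2 * block_rep n S g $$ (2 * c, 2 * c) - 1"
proof -
  have "2 * c < 2 ^ Suc n" using assms by auto
  moreover have "xor (2 * c) 1 \<noteq> 2 * c"
    by (metis xor_cancel xor_self_eq zero_neq_one)
  ultimately show ?thesis
    using assms(2) chi_cases [of c g] by (auto simp: block_rep_entry block_perm_def)
qed

lemma inj_on_block_rep:
  assumes S: "S \<subseteq> {..<2 ^ n}" and sep: "\<And>g. 0 < g \<Longrightarrow> g < 2 ^ n \<Longrightarrow> \<exists>c\<in>S. chi c g = - 1"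
  shows "inj_on (block_rep n S) {..<2 ^ n}"
proof (rule inj_onI)
  fix g h assume gh: "g \<in> {..<2 ^ n}" "h \<in> {..<2 ^ n}" and eq: "block_rep n S g = block_rep n S h"
  have "chi c (xor g h) = 1" if "c \<in> S" for c
  proof -
    have "chi c g = chi c h"
      unfolding chi_eq_block_rep_entry [OF S that] eq ..
    then show ?thesis by (simp add: chi_xor_right)
  qed
  then have "\<not> 0 < xor g h"
    using sep [of "xor g h"] gh xor_less_power_2 by force
  then show "g = h" by (simp add: xor_eq_0_iff)
qed

section \<open>Affine symmetries of the block representation\<close>

text \<open>The map \<open>f\<close> permutes the vertices by some \<open>\<sigma>\<close> and
  preserves the affine relations that express each vertex through the kernel. Hence
  \<open>\<sigma>\<close> preserves the kernel, and by rigidity it is a translation.\<close>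

lemma affine_symmetry_block_rep:
  fixes n :: nat and S :: "nat set"
  defines "d \<equiv> 2 ^ Suc n"
  defines "P \<equiv> mat_convex d hull (block_rep n S ` {..<2 ^ n})"
  assumes S: "S \<subseteq> {..<2 ^ n}" "0 \<in> S" and rigid: "rigid n S"
    and sep: "\<And>g. 0 < g \<Longrightarrow> g < 2 ^ n \<Longrightarrow> \<exists>c\<in>S. chi c g = - 1"
    and f: "mat_affine_map d f" "bij_betw f P P"
  shows "\<exists>a<2 ^ n. \<forall>X\<in>P. f X = block_rep n S a * X"
proof -
  let ?R = "block_rep n S" and ?V = "{..<2 ^ n :: nat}"
  have R: "?R g \<in> carrier_mat d d" for g
    unfolding d_def by (rule block_rep_carrier)
  have R_V: "?R ` ?V \<subseteq> carrier_mat d d"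
    using R by blast
  have inj_R: "inj_on ?R ?V"
    using S(1) sep by (rule inj_on_block_rep)
  have "f (?R g) \<in> ?R ` ?V" if "g < 2 ^ n" for g
  proof (rule affine_bij_hull_zero_one [OF R_V _ f [unfolded P_def]])
    show "A $$ (i, j) \<in> {0, 1}" if "A \<in> ?R ` ?V" "i < d" "j < d" for A i j
      using that by (auto simp: block_rep_entry d_def simp del: power_Suc)
  qed (use that in auto)
  then obtain \<sigma> where \<sigma>: "\<And>g. g < 2 ^ n \<Longrightarrow> \<sigma> g < 2 ^ n" "\<And>g. g < 2 ^ n \<Longrightarrow> f (?R g) = ?R (\<sigma> g)"
    unfolding image_iff by (metis lessThan_iff)
  have "inj_on \<sigma> ?V"
  proof (rule inj_onI)
    fix g h assume gh: "g \<in> ?V" "h \<in> ?V" and "\<sigma> g = \<sigma> h"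
    then have "f (?R g) = f (?R h)" using \<sigma>(2) by simp
    moreover have "?R g \<in> P" "?R h \<in> P"
      unfolding P_def using gh by (auto intro: hull_inc)
    ultimately have "?R g = ?R h"
      using f(2) by (auto simp: bij_betw_def inj_on_def)
    then show "g = h"
      using inj_R gh by (auto simp: inj_on_def)
  qed
  moreover have "\<sigma> ` ?V \<subseteq> ?V" using \<sigma>(1) by auto
  ultimately have bij: "bij_betw \<sigma> ?V ?V"
    by (simp add: bij_betw_def endo_inj_surj)
  \<comment> \<open>Row \<open>h\<close> of the projection kernel, which reproduces the characters
    in \<open>S\<close> and therefore all matrix entries.\<close>
  let ?x = "\<lambda>h g. char_sum S (xor g h) / 2 ^ n"
  have average: "(\<Sum>g\<in>?V. ?x h g * chi c g) = chi c h" if "c \<in> S" for c and h :: nat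
    using sum_char_sum_chi [OF S(1) that, of h] by (simp flip: sum_divide_distrib)
  \<comment> \<open>This is the reproduction of the trivial character.\<close>
  have sum_1: "sum (?x h) ?V = 1" for h :: nat
    using average [OF S(2), of h] by simp
  have R_average: "?R h = mat d d (\<lambda>ij. \<Sum>g\<in>?V. ?x h g * ?R g $$ ij)" for h :: nat
  proof (rule eq_matI)
    fix i j assume "i < dim_row (mat d d (\<lambda>ij. \<Sum>g\<in>?V. ?x h g * ?R g $$ ij))"
      "j < dim_col (mat d d (\<lambda>ij. \<Sum>g\<in>?V. ?x h g * ?R g $$ ij))"
    then have ij: "i < d" "j < d" by auto
    then obtain \<alpha> \<beta> c where c: "c \<in> S" and entry: "\<And>g. ?R g $$ (i, j) = \<alpha> + \<beta> * chi c g"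
      using block_rep_entry_affine [of i n j S] S(2) unfolding d_def by blast
    have "(\<Sum>g\<in>?V. ?x h g * ?R g $$ (i, j)) = sum (?x h) ?V * \<alpha> + \<beta> * (\<Sum>g\<in>?V. ?x h g * chi c g)"
      unfolding entry sum_distrib_left sum_distrib_right sum.distrib [symmetric]
      by (intro sum.cong refl) (simp add: algebra_simps add_divide_distrib)
    also have "\<dots> = ?R h $$ (i, j)"
      unfolding average [OF c] sum_1 entry by simp
    finally show "?R h $$ (i, j) = mat d d (\<lambda>ij. \<Sum>g\<in>?V. ?x h g * ?R g $$ ij) $$ (i, j)"
      using ij by simp
  qed (use R [of h] in auto)
  have R_\<sigma>: "?R (\<sigma> h) = mat d d (\<lambda>ij. \<Sum>g\<in>?V. ?x h g * ?R (\<sigma> g) $$ ij)" if "h < 2 ^ n" for h :: nat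
  proof -
    have "?R (\<sigma> h) = f (mat d d (\<lambda>ij. \<Sum>g\<in>?V. ?x h g * ?R g $$ ij))"
      using \<sigma>(2) [OF that] R_average [of h] by simp
    also have "\<dots> = mat d d (\<lambda>ij. \<Sum>g\<in>?V. ?x h g * f (?R g) $$ ij)"
      using R sum_1 by (intro mat_affine_map_sum [OF f(1)]) auto
    also have "\<dots> = mat d d (\<lambda>ij. \<Sum>g\<in>?V. ?x h g * ?R (\<sigma> g) $$ ij)"
      by (intro eq_matI) (simp_all add: \<sigma>(2))
    finally show ?thesis .
  qed
  \<comment> \<open>Reading \<open>R_\<sigma>\<close> at the diagonal entry that encodes
    \<open>c\<close> gives the assumption \<open>span\<close> of
    \<open>char_sum_invariant\<close>.\<close>
  have inv: "char_sum S (xor (\<sigma> g) (\<sigma> h)) = char_sum S (xor g h)" if "g < 2 ^ n" "h < 2 ^ n" for g h :: nat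
  proof (rule char_sum_invariant [OF S(1) bij _ that])
    fix c h :: nat assume c: "c \<in> S" and h: "h < 2 ^ n"
    have "2 * c < d" using c S(1) by (auto simp: d_def)
    note chi_eq = chi_eq_block_rep_entry [OF S(1) c]
    have "(\<Sum>g\<in>?V. ?x h g * chi c (\<sigma> g)) =
        2 * (\<Sum>g\<in>?V. ?x h g * ?R (\<sigma> g) $$ (2 * c, 2 * c)) - sum (?x h) ?V"
      unfolding chi_eq sum_distrib_left sum_subtractf [symmetric]
      by (intro sum.cong) (simp_all add: algebra_simps)
    also have "(\<Sum>g\<in>?V. ?x h g * ?R (\<sigma> g) $$ (2 * c, 2 * c)) = ?R (\<sigma> h) $$ (2 * c, 2 * c)"
      using R_\<sigma> [OF h] \<open>2 * c < d\<close> by simp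
    also have "2 * ?R (\<sigma> h) $$ (2 * c, 2 * c) - sum (?x h) ?V = chi c (\<sigma> h)"
      unfolding chi_eq sum_1 ..
    finally show "(\<Sum>g<2 ^ n. char_sum S (xor g h) * chi c (\<sigma> g)) = 2 ^ n * chi c (\<sigma> h)"
      by (simp add: field_simps flip: sum_divide_distrib)
  qed
  \<comment> \<open>Translating by \<open>a\<close> makes \<open>\<sigma>\<close> fix
    \<open>0\<close>, as rigidity requires.\<close>
  define a where "a = \<sigma> 0"
  have a: "a < 2 ^ n" by (simp add: a_def \<sigma>(1))
  have "xor a (\<sigma> g) = g" if "g < 2 ^ n" for g
  proof (rule rigidD [OF rigid _ _ _ that])
    show "bij_betw (\<lambda>g. xor a (\<sigma> g)) ?V ?V"
      using bij_betw_trans [OF bij bij_betw_xor [OF a]] by (simp add: comp_def)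
    show "xor a (\<sigma> 0) = 0" by (simp add: a_def)
    show "char_sum S (xor (xor a (\<sigma> g)) (xor a (\<sigma> h))) = char_sum S (xor g h)"
      if "g < 2 ^ n" "h < 2 ^ n" for g h :: nat
    proof -
      have "xor (xor a (\<sigma> g)) (xor a (\<sigma> h)) = xor (\<sigma> g) (\<sigma> h)"
        by (metis xor.assoc xor.commute xor_cancel)
      then show ?thesis using inv [OF that] by simp
    qed
  qed
  then have \<sigma>_eq: "\<sigma> g = xor a g" if "g < 2 ^ n" for g
    using that xor_cancel by metis
  have "f X = ?R a * X" if "X \<in> P" for X
  proof (rule mat_affine_map_eq_on_hull [OF f(1) mat_affine_map_times [OF R] R_V _ that [unfolded P_def]])
    show "f A = ?R a * A" if "A \<in> ?R ` ?V" for A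
      using that \<sigma>(2) \<sigma>_eq by (auto simp: block_rep_xor [OF S(1)])
  qed
  with a show ?thesis by blast
qed

text \<open>Left multiplication permutes the vertices, hence maps their hull into itself; it is an
  involution because \<open>xor a a = 0\<close>.\<close>

lemma block_rep_times_bij:
  fixes n :: nat and S :: "nat set"
  defines "d \<equiv> 2 ^ Suc n"
  defines "P \<equiv> mat_convex d hull (block_rep n S ` {..<2 ^ n})"
  assumes S: "S \<subseteq> {..<2 ^ n}" and a: "a < 2 ^ n"
  shows "bij_betw (\<lambda>X. block_rep n S a * X) P P"
proof -
  let ?R = "block_rep n S" and ?V = "{..<2 ^ n :: nat}"
  have R: "?R g \<in> carrier_mat d d" for g
    unfolding d_def by (rule block_rep_carrier)
  have R_V: "?R ` ?V \<subseteq> carrier_mat d d"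
    using R by blast
  have mem: "?R a * X \<in> P" if "X \<in> P" for X
    using that R_V unfolding P_def
  proof (induction rule: mat_convex_hull_induct)
    case (base X)
    then obtain g where "X = ?R g" "g < 2 ^ n" by auto
    then have "?R a * X \<in> ?R ` ?V"
      using xor_less_power_2 [OF a, of g] by (auto simp flip: block_rep_xor [OF S])
    then show ?case by (rule hull_inc)
  next
    case (combination A B u v)
    have "?R a * (u \<cdot>\<^sub>m A + v \<cdot>\<^sub>m B) = u \<cdot>\<^sub>m (?R a * A) + v \<cdot>\<^sub>m (?R a * B)"
      using combination(1,2,5) mat_convex_hull_carrier [OF R_V]
      by (intro mat_affine_map_combination [OF mat_affine_map_times [OF R]] combination) auto
    then show ?case
      using mat_convexD [OF mat_convex_hull [OF R_V]] combination by simp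
  qed
  have "?R a * (?R a * X) = X" if "X \<in> P" for X
  proof -
    have X: "X \<in> carrier_mat d d"
      using mat_convex_hull_carrier [OF R_V] that by (simp add: P_def)
    have "?R a * (?R a * X) = ?R (xor a a) * X"
      unfolding block_rep_xor [OF S] using assoc_mult_mat [OF R R X] by simp
    also have "\<dots> = X"
      using X by (simp add: block_rep_0 d_def del: power_Suc)
    finally show ?thesis .
  qed
  with mem show ?thesis
    by (intro bij_betw_byWitness [where f' = "\<lambda>X. ?R a * X"]) auto
qed

theorem theorem5:
  fixes G :: "('a, 'b) monoid_scheme"
  assumes "elementary_abelian_2_group G"
    and "finite (carrier G)"
    and "Coset.order G \<notin> {4, 8, 16}"
  shows "\<exists>d>0. \<exists>D. permutation_representation G d D \<and> inj_on D (carrier G) \<and>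
           affine_symmetries d (representation_polytope G d D) =
             (\<lambda>A. restrict (\<lambda>X. A * X) (representation_polytope G d D)) ` (D ` carrier G)"
proof -
  obtain n and \<phi> :: "nat \<Rightarrow> 'a" where bij: "bij_betw \<phi> {..<2 ^ n} (carrier G)"
    and hom: "\<And>a b. a < 2 ^ n \<Longrightarrow> b < 2 ^ n \<Longrightarrow> \<phi> (xor a b) = \<phi> a \<otimes>\<^bsub>G\<^esub> \<phi> b"
    by (rule elementary_abelian_2_group_coordinates [OF assms(1,2)], rule that)
  have "Coset.order G = 2 ^ n"
    using bij_betw_same_card [OF bij] by (simp add: Coset.order_def)
  then have "n \<notin> {2, 3, 4}"
    using assms(3) by auto
  then obtain S where S: "S \<subseteq> {..<2 ^ n}" "rigid n S" "0 \<in> S"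
    and sep: "\<And>g. 0 < g \<Longrightarrow> g < 2 ^ n \<Longrightarrow> \<exists>c\<in>S. chi c g = - 1"
    using exists_rigid [of n] by blast
  define d where "d = (2::nat) ^ Suc n"
  let ?V = "{..<2 ^ n :: nat}"
  let ?\<psi> = "the_inv_into ?V \<phi>"
  define D where "D g = block_rep n S (?\<psi> g)" for g
  have \<psi>_bij: "bij_betw ?\<psi> (carrier G) ?V"
    using bij by (rule bij_betw_the_inv_into)
  have \<psi>: "?\<psi> g < 2 ^ n" "\<phi> (?\<psi> g) = g" if "g \<in> carrier G" for g
    using \<psi>_bij bij that by (auto simp: bij_betw_def f_the_inv_into_f)
  have D_carrier: "D g \<in> carrier_mat d d" for g
    unfolding D_def d_def by (rule block_rep_carrier)
  have D_image: "D ` carrier G = block_rep n S ` ?V"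
    using \<psi>_bij by (simp add: D_def bij_betw_def flip: image_image)
  have D_mult: "D (g \<otimes>\<^bsub>G\<^esub> h) = D g * D h" if "g \<in> carrier G" "h \<in> carrier G" for g h
  proof -
    have "g \<otimes>\<^bsub>G\<^esub> h = \<phi> (xor (?\<psi> g) (?\<psi> h))"
      using \<psi> that by (simp add: hom)
    then have "?\<psi> (g \<otimes>\<^bsub>G\<^esub> h) = xor (?\<psi> g) (?\<psi> h)"
      using bij \<psi> that xor_less_power_2 by (simp add: bij_betw_def the_inv_into_f_f)
    then show ?thesis
      by (simp add: D_def block_rep_xor [OF S(1)])
  qed
  \<comment> \<open>Each \<open>D g\<close> is its own inverse, which puts it into
    \<open>GL d\<close>.\<close>
  have D_square: "D g * D g = 1\<^sub>m d" for g
    unfolding D_def d_def block_rep_xor [OF S(1), symmetric] by (simp only: xor_self_eq block_rep_0)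
  have "D g \<in> carrier (GL d)" for g
    using D_carrier D_square by (auto simp: GL_def units_of_def Units_def ring_mat_def)
  moreover have "permutation_matrix d (D g)" for g
    unfolding permutation_matrix_def D_def d_def block_rep_def perm_mat_def
    using block_perm_permutes [OF S(1)] by blast
  ultimately have "permutation_representation G d D"
    using D_mult by (auto simp: permutation_representation_def hom_def GL_def units_of_def ring_mat_def)
  moreover have "inj_on D (carrier G)"
    using comp_inj_on [of ?\<psi> "carrier G" "block_rep n S"] \<psi>_bij inj_on_block_rep [OF S(1) sep]
    by (simp add: D_def [abs_def] comp_def bij_betw_def)
  moreover have "affine_symmetries d (representation_polytope G d D) =
      (\<lambda>A. restrict (\<lambda>X. A * X) (representation_polytope G d D)) ` (D ` carrier G)"
    (is "_ = ?rhs")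
  proof -
    let ?P = "mat_convex d hull (block_rep n S ` ?V)"
    have "restrict f ?P \<in> (\<lambda>A. restrict (\<lambda>X. A * X) ?P) ` (block_rep n S ` ?V)"
      if "mat_affine_map d f" "bij_betw f ?P ?P" for f
    proof -
      have "\<exists>a<2 ^ n. \<forall>X\<in>?P. f X = block_rep n S a * X"
        using that unfolding d_def by (intro affine_symmetry_block_rep S sep)
      then obtain a where "a < 2 ^ n" "\<forall>X\<in>?P. f X = block_rep n S a * X"
        by blast
      then show ?thesis by (auto simp: image_iff intro!: bexI [of _ a] restrict_ext)
    qed
    moreover have "mat_affine_map d (\<lambda>X. block_rep n S a * X)"
      "bij_betw (\<lambda>X. block_rep n S a * X) ?P ?P" if "a < 2 ^ n" for a
      unfolding d_def using block_rep_times_bij [OF S(1) that]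
      by (simp_all only: mat_affine_map_times block_rep_carrier)
    ultimately show ?thesis
      unfolding representation_polytope_def D_image affine_symmetries_def by blast
  qed
  moreover have "0 < d" by (simp add: d_def)
  ultimately show ?thesis by blast
qed

end
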